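(* Consider the three-phase two-bus system whose line has no mutual impedances and has equal self-resistances $R\ge0$ and equal self-reactances $X>0$ on the three phases, with $R/X$ ratio $d:=R/X$ and line length $L_1:=\sqrt{R^2+X^2}$. For the phasor-based control (PBC) closed-loop matrix $$A-BF=I_6-\begin{bmatrix}X I_3 & R I_3 \\ -\tfrac12 R I_3 & \tfrac12 X I_3\end{bmatrix}\begin{bmatrix}a I_3 & 0 \\ 0 & 2a I_3\end{bmatrix},$$ and likewise for the droop control closed-loop matrix $$A-BF=0^{3\times3}-\begin{bmatrix}X I_3 & R I_3\end{bmatrix}\begin{bmatrix}a I_3 \\ a I_3\end{bmatrix},$$ increasing the line $R/X$ ratio (up to $R/X=1$), with the line length $L_1$ held fixed, reduces the range of stabilizing controller gains $[0,a_{crit}]$. That is, for each of the two models and each fixed $L_1>0$, if $0\le d<d'\le1$ then $a_{crit}(d')<a_{crit}(d)$, where $a_{crit}(d)$ is the critical gain of that model for the line with length $L_1$ and $R/X$ ratio $d$.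
   Context: The two-bus network is a slack (substation) bus connected by one three-phase line to a bus carrying a constant-power load and a controlled distributed energy resource (DER). The line has a $3\times3$ resistance matrix $(R_{ij})$ and a $3\times 3$ reactance matrix $(X_{ij})$; here $R_{ij}=X_{ij}=0$ for $i\ne j$, $R:=R_{11}=R_{22}=R_{33}$ and $X:=X_{11}=X_{22}=X_{33}$. The $R/X$ ratios of the three phases, $R_{ii}/X_{ii}$, are then all equal to $d=R/X$. $I_m$ denotes the $m\times m$ identity matrix. The closed-loop discrete-time dynamics are governed by the matrix $A-BF$, where $B$ is the impedance matrix and $F$ is the controller gain matrix, parametrized by a scalar gain $a\ge0$. Critical gain: $a_{crit}>0$ is the controller gain $a>0$ that puts the dominant (maximum magnitude) eigenvalue of $A-BF$ on the verge of instability, i.e. the $a>0$ for which $\max_i|\lambda_i(A-BF)|=1$. The range of stabilizing controller gains is $[0,a_{crit}]$. *)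

theory Defs
  imports "Jordan_Normal_Form.Spectral_Radius"
begin

definition pbc_B :: "real \<Rightarrow> real \<Rightarrow> real mat" where
  "pbc_B R X = four_block_mat
     (X \<cdot>\<^sub>m 1\<^sub>m 3)           (R \<cdot>\<^sub>m 1\<^sub>m 3)
     ((- (1/2) * R) \<cdot>\<^sub>m 1\<^sub>m 3) ((1/2 * X) \<cdot>\<^sub>m 1\<^sub>m 3)"

definition pbc_F :: "real \<Rightarrow> real mat" where
  "pbc_F a = four_block_mat
     (a \<cdot>\<^sub>m 1\<^sub>m 3) (0\<^sub>m 3 3)
     (0\<^sub>m 3 3)     ((2 * a) \<cdot>\<^sub>m 1\<^sub>m 3)"

definition pbc_closed_loop :: "real \<Rightarrow> real \<Rightarrow> real \<Rightarrow> real mat" where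
  "pbc_closed_loop R X a = 1\<^sub>m 6 - pbc_B R X * pbc_F a"

(* The 3 x 6 block row [X I, R I]: the lower blocks have no rows. *)
definition droop_B :: "real \<Rightarrow> real \<Rightarrow> real mat" where
  "droop_B R X = four_block_mat
     (X \<cdot>\<^sub>m 1\<^sub>m 3) (R \<cdot>\<^sub>m 1\<^sub>m 3)
     (0\<^sub>m 0 3)     (0\<^sub>m 0 3)"

definition droop_F :: "real \<Rightarrow> real mat" where
  "droop_F a = (a \<cdot>\<^sub>m 1\<^sub>m 3) @\<^sub>r (a \<cdot>\<^sub>m 1\<^sub>m 3)"

definition droop_closed_loop :: "real \<Rightarrow> real \<Rightarrow> real \<Rightarrow> real mat" where
  "droop_closed_loop R X a = 0\<^sub>m 3 3 - droop_B R X * droop_F a"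

(* M is a closed-loop matrix as a function of the scalar gain. Its eigenvalues are
   taken over the complex numbers. *)
definition is_critical_gain :: "(real \<Rightarrow> real mat) \<Rightarrow> real \<Rightarrow> bool" where
  "is_critical_gain M a \<longleftrightarrow>
     a > 0 \<and> spectral_radius (map_mat complex_of_real (M a)) = 1"

(* Unspecified unless exactly one critical gain exists. *)
definition critical_gain :: "(real \<Rightarrow> real mat) \<Rightarrow> real" where
  "critical_gain M = (THE a. is_critical_gain M a)"

definition stabilizing_gains :: "(real \<Rightarrow> real mat) \<Rightarrow> real set" where
  "stabilizing_gains M = {0..critical_gain M}"

(* A line without mutual impedances and with the same self-resistance R and
   self-reactance X on each phase, of length L and R/X ratio d. *)
definition balanced_line :: "real \<Rightarrow> real \<Rightarrow> real \<Rightarrow> real \<Rightarrow> bool" where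
  "balanced_line L d R X \<longleftrightarrow>
     R \<ge> 0 \<and> X > 0 \<and> sqrt (R\<^sup>2 + X\<^sup>2) = L \<and> R / X = d"

end

theory Submission
  imports Defs
begin

text \<open>
  All blocks are scalar multiples of the identity, so the spectra are explicit: the PBC matrix has
  the eigenvalues \<open>1 - aX \<plusminus> iaR\<close>, of squared modulus \<open>1 - 2aX + a\<^sup>2L\<^sup>2\<close>, and the droop matrix the
  eigenvalue \<open>-a(X + R)\<close>. Hence the critical gains are \<open>2X/L\<^sup>2\<close> and \<open>1/(X + R)\<close>. At fixed \<open>L\<close>,
  increasing \<open>d\<close> decreases \<open>X\<^sup>2 = L\<^sup>2/(1 + d\<^sup>2)\<close> and, as long as \<open>d \<le> 1\<close>, increases
  \<open>(X + R)\<^sup>2 = L\<^sup>2(1 + 2d/(1 + d\<^sup>2))\<close>.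
\<close>

lemma mult_scalar_mats:
  fixes p q :: "'a :: comm_ring_1"
  shows "(p \<cdot>\<^sub>m 1\<^sub>m n) * (q \<cdot>\<^sub>m 1\<^sub>m n) = (p * q) \<cdot>\<^sub>m 1\<^sub>m n"
proof -
  have "(p \<cdot>\<^sub>m 1\<^sub>m n) * (q \<cdot>\<^sub>m 1\<^sub>m n) = p \<cdot>\<^sub>m (1\<^sub>m n * (q \<cdot>\<^sub>m 1\<^sub>m n))"
    by (rule mult_smult_assoc_mat[of _ n n _ n]) auto
  then show ?thesis
    by (auto intro!: eq_matI)
qed

text \<open>Scalar blocks commute, so the block determinant is that of the single block
  \<open>p * s - q * r\<close> times the identity.\<close>

lemma det_scalar_blocks:
  fixes p q r s :: "'a :: idom"
  shows "det (four_block_mat (p \<cdot>\<^sub>m 1\<^sub>m n) (q \<cdot>\<^sub>m 1\<^sub>m n) (r \<cdot>\<^sub>m 1\<^sub>m n) (s \<cdot>\<^sub>m 1\<^sub>m n)) = (p * s - q * r) ^ n"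
proof -
  have "det (four_block_mat (p \<cdot>\<^sub>m 1\<^sub>m n) (q \<cdot>\<^sub>m 1\<^sub>m n) (r \<cdot>\<^sub>m 1\<^sub>m n) (s \<cdot>\<^sub>m 1\<^sub>m n))
      = det ((p * s) \<cdot>\<^sub>m 1\<^sub>m n - (q * r) \<cdot>\<^sub>m 1\<^sub>m n)"
    by (subst det_four_block_mat[of _ n]) (auto simp: mult_scalar_mats mult.commute)
  also have "(p * s) \<cdot>\<^sub>m 1\<^sub>m n - (q * r) \<cdot>\<^sub>m 1\<^sub>m n = (p * s - q * r) \<cdot>\<^sub>m 1\<^sub>m n"
    by (auto intro!: eq_matI)
  finally show ?thesis
    by simp
qed

text \<open>Subtracting \<open>k\<close> from the diagonal keeps all four blocks scalar, so the
  determinant is the \<open>n\<close>-th power of a 2x2 determinant. With \<open>n > 0\<close> it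
  vanishes exactly when its base does.\<close>

lemma spectrum_scalar_blocks:
  fixes p q r s :: "'a :: field"
  assumes "n > 0"
  shows "spectrum (four_block_mat (p \<cdot>\<^sub>m 1\<^sub>m n) (q \<cdot>\<^sub>m 1\<^sub>m n) (r \<cdot>\<^sub>m 1\<^sub>m n) (s \<cdot>\<^sub>m 1\<^sub>m n))
    = {k. (p - k) * (s - k) = q * r}"
proof -
  let ?M = "four_block_mat (p \<cdot>\<^sub>m 1\<^sub>m n) (q \<cdot>\<^sub>m 1\<^sub>m n) (r \<cdot>\<^sub>m 1\<^sub>m n) (s \<cdot>\<^sub>m 1\<^sub>m n)"
  have M: "?M \<in> carrier_mat (n + n) (n + n)"
    by auto
  have "char_matrix ?M k
      = four_block_mat ((p - k) \<cdot>\<^sub>m 1\<^sub>m n) (q \<cdot>\<^sub>m 1\<^sub>m n) (r \<cdot>\<^sub>m 1\<^sub>m n) ((s - k) \<cdot>\<^sub>m 1\<^sub>m n)" for k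
    by (rule eq_matI) (auto simp: char_matrix_def)
  then show ?thesis
    using assms by (auto simp: spectrum_def eigenvalue_det[OF M] det_scalar_blocks)
qed

lemma spectrum_scalar_mat:
  fixes p :: "'a :: field"
  assumes "n > 0"
  shows "spectrum (p \<cdot>\<^sub>m 1\<^sub>m n) = {p}"
proof -
  have M: "p \<cdot>\<^sub>m 1\<^sub>m n \<in> carrier_mat n n"
    by auto
  have "char_matrix (p \<cdot>\<^sub>m 1\<^sub>m n) k = (p - k) \<cdot>\<^sub>m 1\<^sub>m n" for k
    by (rule eq_matI) (auto simp: char_matrix_def)
  then show ?thesis
    using assms by (auto simp: spectrum_def eigenvalue_det[OF M])
qed

lemma pbc_closed_loop_eq:
  "pbc_closed_loop R X a = four_block_mat
     ((1 - a * X) \<cdot>\<^sub>m 1\<^sub>m 3) ((- 2 * a * R) \<cdot>\<^sub>m 1\<^sub>m 3)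
     ((a * R / 2) \<cdot>\<^sub>m 1\<^sub>m 3) ((1 - a * X) \<cdot>\<^sub>m 1\<^sub>m 3)"
proof -
  have "pbc_B R X * pbc_F a = four_block_mat
     ((X * a) \<cdot>\<^sub>m 1\<^sub>m 3) ((R * (2 * a)) \<cdot>\<^sub>m 1\<^sub>m 3)
     ((- (1/2) * R * a) \<cdot>\<^sub>m 1\<^sub>m 3) ((1/2 * X * (2 * a)) \<cdot>\<^sub>m 1\<^sub>m 3)"
    unfolding pbc_B_def pbc_F_def
    by (subst mult_four_block_mat[of _ 3 3 _ 3 _ 3 _ _ 3 _ 3])
      (auto simp: mult_scalar_mats intro!: cong_four_block_mat)
  then show ?thesis
    unfolding pbc_closed_loop_def by (auto intro!: eq_matI)
qed

lemma droop_closed_loop_eq: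
  "droop_closed_loop R X a = (- (a * (X + R))) \<cdot>\<^sub>m 1\<^sub>m 3"
proof -
  \<comment> \<open>Stacking rows is a block matrix whose right-hand blocks have width 0, so block
    multiplication applies and the product is merely padded by empty blocks.\<close>
  have "droop_B R X * droop_F a
      = four_block_mat ((X * a) \<cdot>\<^sub>m 1\<^sub>m 3 + (R * a) \<cdot>\<^sub>m 1\<^sub>m 3) (0\<^sub>m 3 0) (0\<^sub>m 0 3) (0\<^sub>m 0 0)"
    unfolding droop_B_def droop_F_def append_rows_def
    by (subst mult_four_block_mat[of _ 3 3 _ 3 _ 0 _ _ 3 _ 0])
      (auto simp: mult_scalar_mats intro!: cong_four_block_mat)
  then show ?thesis
    unfolding droop_closed_loop_def by (auto intro!: eq_matI simp: algebra_simps)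
qed

lemma spectral_radius_pbc:
  "spectral_radius (map_mat complex_of_real (pbc_closed_loop R X a)) = sqrt ((1 - a * X)\<^sup>2 + (a * R)\<^sup>2)"
proof -
  have "map_mat complex_of_real (pbc_closed_loop R X a) = four_block_mat
     (of_real (1 - a * X) \<cdot>\<^sub>m 1\<^sub>m 3) (of_real (- 2 * a * R) \<cdot>\<^sub>m 1\<^sub>m 3)
     (of_real (a * R / 2) \<cdot>\<^sub>m 1\<^sub>m 3) (of_real (1 - a * X) \<cdot>\<^sub>m 1\<^sub>m 3)"
    unfolding pbc_closed_loop_eq by (auto intro!: eq_matI)
  then have "spectrum (map_mat complex_of_real (pbc_closed_loop R X a))
      = {k. (of_real (1 - a * X) - k) * (of_real (1 - a * X) - k)
              = of_real (- 2 * a * R) * of_real (a * R / 2)}"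
    by (simp add: spectrum_scalar_blocks)
  \<comment> \<open>The off-diagonal product is \<open>- (a * R)\<^sup>2\<close>, a square over the
    complex numbers, so the roots can be read off.\<close>
  also have "\<dots> = {k. (k - of_real (1 - a * X))\<^sup>2 = (\<i> * of_real (a * R))\<^sup>2}"
    by (simp add: power2_eq_square algebra_simps)
  also have "\<dots> = {Complex (1 - a * X) (a * R), Complex (1 - a * X) (- (a * R))}"
    unfolding power2_eq_iff by (auto simp: complex_eq_iff)
  \<comment> \<open>The two eigenvalues are conjugate, so the maximum ranges over a single
    modulus.\<close>
  finally show ?thesis
    unfolding spectral_radius_def by (simp add: cmod_def)
qed

lemma spectral_radius_droop:
  "spectral_radius (map_mat complex_of_real (droop_closed_loop R X a)) = \<bar>a * (X + R)\<bar>"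
proof -
  have "map_mat complex_of_real (droop_closed_loop R X a) = of_real (- (a * (X + R))) \<cdot>\<^sub>m 1\<^sub>m 3"
    unfolding droop_closed_loop_eq by (auto intro!: eq_matI)
  then have "spectrum (map_mat complex_of_real (droop_closed_loop R X a)) = {of_real (- (a * (X + R)))}"
    by (simp only: spectrum_scalar_mat)
  then show ?thesis
    unfolding spectral_radius_def by (simp only: image_insert image_empty norm_of_real) simp
qed

lemma is_critical_gain_pbc:
  assumes "X > 0"
  shows "is_critical_gain (pbc_closed_loop R X) a \<longleftrightarrow> a = 2 * X / (R\<^sup>2 + X\<^sup>2)"
proof -
  have pos: "R\<^sup>2 + X\<^sup>2 > 0"
    using assms by (simp add: add_nonneg_pos)
  \<comment> \<open>The constant terms cancel, leaving the root \<open>a = 0\<close>, which the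
    positivity in \<open>is_critical_gain\<close> excludes.\<close>
  have "(1 - a * X)\<^sup>2 + (a * R)\<^sup>2 = 1 \<longleftrightarrow> a * (a * (R\<^sup>2 + X\<^sup>2) - 2 * X) = 0"
    by (auto simp: power2_eq_square algebra_simps)
  also have "\<dots> \<longleftrightarrow> a = 0 \<or> a = 2 * X / (R\<^sup>2 + X\<^sup>2)"
    using less_imp_neq[OF pos] by (simp add: eq_divide_eq del: sum_power2_eq_zero_iff)
  finally show ?thesis
    using assms pos by (auto simp: is_critical_gain_def spectral_radius_pbc)
qed

lemma is_critical_gain_droop:
  assumes "X > 0" "R \<ge> 0"
  shows "is_critical_gain (droop_closed_loop R X) a \<longleftrightarrow> a = 1 / (X + R)"
proof -
  have pos: "X + R > 0"
    using assms by simp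
  have "is_critical_gain (droop_closed_loop R X) a \<longleftrightarrow> a > 0 \<and> a * (X + R) = 1"
    using pos by (auto simp: is_critical_gain_def spectral_radius_droop abs_mult)
  also have "\<dots> \<longleftrightarrow> a = 1 / (X + R)"
    using pos zero_less_mult_pos2[of a "X + R"] by (auto simp: nonzero_eq_divide_eq)
  finally show ?thesis .
qed

text \<open>The equivalence supplies both existence and uniqueness for the definite
  description.\<close>

lemma critical_gain_eqI:
  assumes "\<And>a. is_critical_gain M a \<longleftrightarrow> a = c"
  shows "critical_gain M = c"
  unfolding critical_gain_def assms by simp

lemma balanced_line_param:
  assumes "balanced_line L d R X"
  shows "X > 0" "R = d * X" "R\<^sup>2 + X\<^sup>2 = L\<^sup>2"
  using assms by (auto simp: balanced_line_def)

text \<open>If the reactance did not drop, the resistance \<open>d * X\<close> would strictly grow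
  with the ratio, and the length could not stay fixed.\<close>

lemma balanced_line_reactance_less:
  assumes "0 \<le> d" "d < d'" "balanced_line L d R X" "balanced_line L d' R' X'"
  shows "X' < X"
proof (rule ccontr)
  note l = balanced_line_param[OF assms(3)] and l' = balanced_line_param[OF assms(4)]
  assume "\<not> X' < X"
  then have "X\<^sup>2 \<le> X'\<^sup>2" "d * X < d' * X'"
    using l l' assms by (auto intro: power_mono mult_strict_mono' mult_less_le_imp_less)
  moreover from this(2) have "(d * X)\<^sup>2 < (d' * X')\<^sup>2"
    using l assms by (intro power_strict_mono) auto
  ultimately show False
    using l(3) l'(3) unfolding l(2) l'(2) by linarith
qed

lemma balanced_line_sum_less:
  assumes "0 \<le> d" "d < d'" "d' \<le> 1" "balanced_line L d R X" "balanced_line L d' R' X'"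
  shows "X + R < X' + R'"
proof -
  note l = balanced_line_param[OF assms(4)] and l' = balanced_line_param[OF assms(5)]
  have "X' < X"
    using balanced_line_reactance_less assms by blast
  then have "X'\<^sup>2 < X\<^sup>2"
    using l' by (intro power_strict_mono) auto
  then have "R\<^sup>2 < R'\<^sup>2"
    using l(3) l'(3) by linarith
  moreover have "R' \<ge> 0"
    using assms by (auto simp: balanced_line_def)
  ultimately have "R < R'"
    by (rule power_less_imp_less_base)
  \<comment> \<open>This is where \<open>d' \<le> 1\<close> enters: it keeps \<open>X' - R'\<close>
    nonnegative, so that squaring preserves the order of the differences.\<close>
  have "R' \<le> X'"
    using l'(1,2) assms(3) mult_right_mono[of d' 1 X'] by simp
  \<comment> \<open>The pair with the smaller difference has the larger sum, as both have \<open>X\<^sup>2 + R\<^sup>2 = L\<^sup>2\<close>.\<close>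
  have "(X' - R')\<^sup>2 < (X - R)\<^sup>2"
    using \<open>X' < X\<close> \<open>R < R'\<close> \<open>R' \<le> X'\<close> by (intro power_strict_mono) auto
  then have "(X + R)\<^sup>2 < (X' + R')\<^sup>2"
    using l(3) l'(3) unfolding power2_sum power2_diff by linarith
  moreover have "X' + R' \<ge> 0"
    using l'(1) \<open>R' \<ge> 0\<close> by simp
  ultimately show ?thesis
    by (rule power_less_imp_less_base)
qed

theorem proposition2:
  fixes L d d' R X R' X' :: real
    and cl :: "real \<Rightarrow> real \<Rightarrow> real \<Rightarrow> real mat"
  assumes "L > 0"
    and "0 \<le> d" and "d < d'" and "d' \<le> 1"
    and "balanced_line L d R X"
    and "balanced_line L d' R' X'"
    and "cl = pbc_closed_loop \<or> cl = droop_closed_loop"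
  shows "(\<exists>!a. is_critical_gain (cl R X) a)
    \<and> (\<exists>!a. is_critical_gain (cl R' X') a)
    \<and> critical_gain (cl R' X') < critical_gain (cl R X)
    \<and> stabilizing_gains (cl R' X') \<subset> stabilizing_gains (cl R X)"
proof -
  note l = balanced_line_param[OF assms(5)] and l' = balanced_line_param[OF assms(6)]
  have R: "R \<ge> 0" "R' \<ge> 0"
    using assms by (auto simp: balanced_line_def)
  \<comment> \<open>All that is needed from either model: unique critical gains with
    \<open>0 < c' < c\<close>.\<close>
  obtain c c' where c: "\<And>a. is_critical_gain (cl R X) a \<longleftrightarrow> a = c"
    and c': "\<And>a. is_critical_gain (cl R' X') a \<longleftrightarrow> a = c'"
    and c_pos: "0 < c'" and c_less: "c' < c"
    using assms(7)
  proof
    assume cl: "cl = pbc_closed_loop"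
    show thesis
    proof (rule that)
      show "is_critical_gain (cl R X) a \<longleftrightarrow> a = 2 * X / L\<^sup>2" for a
        using is_critical_gain_pbc[OF l(1), of R] l(3) cl by simp
      show "is_critical_gain (cl R' X') a \<longleftrightarrow> a = 2 * X' / L\<^sup>2" for a
        using is_critical_gain_pbc[OF l'(1), of R'] l'(3) cl by simp
      show "0 < 2 * X' / L\<^sup>2" "2 * X' / L\<^sup>2 < 2 * X / L\<^sup>2"
        using l'(1) assms(1) balanced_line_reactance_less[OF assms(2,3,5,6)]
        by (auto intro!: divide_strict_right_mono)
    qed
  next
    assume cl: "cl = droop_closed_loop"
    show thesis
    proof (rule that)
      show "is_critical_gain (cl R X) a \<longleftrightarrow> a = 1 / (X + R)" for a
        using is_critical_gain_droop l(1) R(1) cl by simp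
      show "is_critical_gain (cl R' X') a \<longleftrightarrow> a = 1 / (X' + R')" for a
        using is_critical_gain_droop l'(1) R(2) cl by simp
      show "0 < 1 / (X' + R')" "1 / (X' + R') < 1 / (X + R)"
        using l(1) l'(1) R balanced_line_sum_less[OF assms(2-6)]
        by (auto intro!: divide_strict_left_mono mult_pos_pos)
    qed
  qed
  \<comment> \<open>The inclusion is strict because \<open>c\<close>, being positive, lies in the
    larger interval only; for negative endpoints both intervals would be empty.\<close>
  have "{0..c'} \<subset> {0..c}"
    using c_pos c_less by (auto simp: psubset_eq)
  then show ?thesis
    using c_less
    by (simp add: stabilizing_gains_def c c' critical_gain_eqI[OF c] critical_gain_eqI[OF c'])
qed

end
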